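(* Let $P$ be a standard RAP with parameters $k,m,n$ and zero set $Z$, and suppose that the first column belongs to every $(k-1)$-cover of $Z$. Let $P'$ be the standard RAP obtained from $P$ by deleting the first column and decreasing $k$ and $n$ by $1$. If the cover formula holds for $P'$, then it holds for $P$.
   Context: A $k$-assignment in an $m\times n$ matrix ($\min(m,n)\ge k$) is a set of $k$ positions, no two in the same row or column; its cost is the sum of the entries there. A standard RAP $Q$ is given by $k,m,n$ and a set $Z$ of positions: entries at positions of $Z$ are $0$, all others are independent exponential random variables with intensity $1$; $E(Q)$ is the expected minimal cost of a $k$-assignment. A set of rows and columns covers $Z$ if each position of $Z$ lies in one of its rows or columns; a cover with $s$ rows and columns in total is an $s$-cover; a partial $(k-1)$-cover is a subset of some $(k-1)$-cover of $Z$; $d_{i,j}(Q)$ is the number of partial $(k-1)$-covers of $Z$ with exactly $i$ rows and $j$ columns. "The cover formula holds for $Q$" (with its parameters $k,m,n$) means $E(Q)=\frac{1}{mn}\sum_{i,j}\frac{d_{i,j}(Q)}{\binom{m-1}{i}\binom{n-1}{j}}$, summed over nonnegative integers $i,j$ with $i+j<k$. *)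

theory Defs
  imports "HOL-Probability.Probability"
begin

text \<open>
  Rows are numbered from 0 to m - 1 and columns from 0 to n - 1, so that the first column has
  index 0. A position is a pair (row, column).
\<close>

definition positions :: "nat \<Rightarrow> nat \<Rightarrow> (nat \<times> nat) set" where
  "positions m n = {..<m} \<times> {..<n}"

definition k_assignment :: "nat \<Rightarrow> nat \<Rightarrow> nat \<Rightarrow> (nat \<times> nat) set \<Rightarrow> bool" where
  "k_assignment k m n S \<longleftrightarrow>
     S \<subseteq> positions m n \<and> card S = k \<and> inj_on fst S \<and> inj_on snd S"

definition min_cost :: "nat \<Rightarrow> nat \<Rightarrow> nat \<Rightarrow> (nat \<times> nat \<Rightarrow> real) \<Rightarrow> real" where
  "min_cost k m n A = Min ((\<lambda>S. \<Sum>p\<in>S. A p) ` {S. k_assignment k m n S})"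

definition standard_rap :: "nat \<Rightarrow> nat \<Rightarrow> nat \<Rightarrow> (nat \<times> nat) set \<Rightarrow> bool" where
  "standard_rap k m n Z \<longleftrightarrow> k \<le> min m n \<and> Z \<subseteq> positions m n"

text \<open>
  The nonzero entries of the matrix form the coordinates of a point of a product space, which
  makes them independent with the exponential distribution of intensity 1.
\<close>

definition rap_space :: "nat \<Rightarrow> nat \<Rightarrow> (nat \<times> nat) set \<Rightarrow> (nat \<times> nat \<Rightarrow> real) measure" where
  "rap_space m n Z =
     (\<Pi>\<^sub>M p \<in> positions m n - Z. density lborel (\<lambda>x. ennreal (exponential_density 1 x)))"

definition rap_entry :: "(nat \<times> nat) set \<Rightarrow> (nat \<times> nat \<Rightarrow> real) \<Rightarrow> nat \<times> nat \<Rightarrow> real" where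
  "rap_entry Z \<omega> p = (if p \<in> Z then 0 else \<omega> p)"

definition rap_expectation :: "nat \<Rightarrow> nat \<Rightarrow> nat \<Rightarrow> (nat \<times> nat) set \<Rightarrow> real" where
  "rap_expectation k m n Z = (\<integral>\<omega>. min_cost k m n (rap_entry Z \<omega>) \<partial>rap_space m n Z)"

text \<open>A set of rows and columns is given by its set R of rows and its set C of columns.\<close>

definition is_cover ::
  "nat \<Rightarrow> nat \<Rightarrow> (nat \<times> nat) set \<Rightarrow> nat \<Rightarrow> nat set \<Rightarrow> nat set \<Rightarrow> bool" where
  "is_cover m n Z s R C \<longleftrightarrow>
     R \<subseteq> {..<m} \<and> C \<subseteq> {..<n} \<and> card R + card C = s \<and> (\<forall>(i, j)\<in>Z. i \<in> R \<or> j \<in> C)"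

definition partial_cover ::
  "nat \<Rightarrow> nat \<Rightarrow> (nat \<times> nat) set \<Rightarrow> nat \<Rightarrow> nat set \<Rightarrow> nat set \<Rightarrow> bool" where
  "partial_cover m n Z s R C \<longleftrightarrow> (\<exists>R' C'. is_cover m n Z s R' C' \<and> R \<subseteq> R' \<and> C \<subseteq> C')"

text \<open>
  The truncated difference k - 1 is harmless for k = 0: the sum in the cover formula is then
  empty, and the formula reads 0 = 0, even if m or n is 0.
\<close>

definition cover_coeff ::
  "nat \<Rightarrow> nat \<Rightarrow> nat \<Rightarrow> (nat \<times> nat) set \<Rightarrow> nat \<Rightarrow> nat \<Rightarrow> nat" where
  "cover_coeff k m n Z i j =
     card {(R, C). partial_cover m n Z (k - 1) R C \<and> card R = i \<and> card C = j}"

definition cover_formula :: "nat \<Rightarrow> nat \<Rightarrow> nat \<Rightarrow> (nat \<times> nat) set \<Rightarrow> bool" where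
  "cover_formula k m n Z \<longleftrightarrow>
     rap_expectation k m n Z =
       1 / (real m * real n) *
       (\<Sum>(i, j)\<in>{(i, j). i + j < k}.
          real (cover_coeff k m n Z i j) /
            (real ((m - 1) choose i) * real ((n - 1) choose j)))"

text \<open>The zero set after deletion of column 0; column j + 1 becomes column j.\<close>

definition delete_first_column :: "(nat \<times> nat) set \<Rightarrow> (nat \<times> nat) set" where
  "delete_first_column Z = {(i, j). (i, Suc j) \<in> Z}"

end

theory Submission
  imports Defs
begin

text \<open>
  Deleting the first column does not change the minimal cost: dropping the entry of a
  k-assignment in that column does not increase its cost, and conversely an optimal
  (k - 1)-assignment of the smaller matrix can be augmented along zeros, since otherwise some
  (k - 1)-cover would avoid the first column. The (k - 1)-covers of P are the (k - 2)-covers of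
  P' with the first column added, so that d(i, j) = d'(i, j) + d'(i, j - 1), and the cover
  formulas agree because of an identity for reciprocals of binomial coefficients.
\<close>

section \<open>Elementary operations on k-assignments\<close>

lemma finite_positions [simp]: "finite (positions m n)"
  by (simp add: positions_def)

lemma finite_k_assignments: "finite {S. k_assignment k m n S}"
  by (rule finite_subset[of _ "Pow (positions m n)"]) (auto simp: k_assignment_def)

lemma k_assignment_finite: "k_assignment k m n S \<Longrightarrow> finite S"
  unfolding k_assignment_def by (meson finite_positions finite_subset)

lemma ex_k_assignment:
  assumes "k \<le> m" "k \<le> n"
  shows "\<exists>S. k_assignment k m n S"
proof -
  have "k_assignment k m n ((\<lambda>i. (i, i)) ` {..<k})"
    using assms by (auto simp: k_assignment_def positions_def card_image inj_on_def)
  then show ?thesis ..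
qed

lemma k_assignment_insert:
  assumes T: "k_assignment k m n T"
    and "r < m" "c < n" "r \<notin> fst ` T" "c \<notin> snd ` T"
  shows "k_assignment (Suc k) m n (insert (r, c) T)"
proof -
  have "(r, c) \<notin> T" using assms(4) by force
  moreover have "T - {(r, c)} = T" using calculation by blast
  ultimately show ?thesis
    using assms k_assignment_finite[OF T]
    by (simp add: k_assignment_def positions_def)
qed

lemma k_assignment_remove:
  assumes "k_assignment (Suc k) m n S" "p \<in> S"
  shows "k_assignment k m n (S - {p})"
  using assms k_assignment_finite[OF assms(1)]
  by (auto simp: k_assignment_def intro: inj_on_subset)

text \<open>One step of an alternating path: the entry in column \<open>c\<close> moves from row
  \<open>r'\<close> to the free row \<open>r\<close>, which frees \<open>r'\<close> and keeps the
  set of used columns.\<close>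

lemma k_assignment_swap:
  assumes T: "k_assignment k m n T" and "(r', c) \<in> T" "r < m" "r \<notin> fst ` T"
  defines "S \<equiv> insert (r, c) (T - {(r', c)})"
  shows "k_assignment k m n S" "snd ` S = snd ` T" "r' \<notin> fst ` S"
proof -
  have inj: "inj_on fst T" "inj_on snd T" and sub: "T \<subseteq> positions m n" and "card T = k"
    using T by (auto simp: k_assignment_def)
  have "k > 0" using \<open>(r', c) \<in> T\<close> k_assignment_finite[OF T] \<open>card T = k\<close>
    by (auto simp: card_gt_0_iff)
  then obtain l where l: "k = Suc l" by (cases k) auto
  have "k_assignment l m n (T - {(r', c)})"
    using k_assignment_remove assms(2) T l by blast
  moreover have "c \<notin> snd ` (T - {(r', c)})"
    using inj(2) \<open>(r', c) \<in> T\<close> by (force simp: inj_on_def)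
  moreover have "c < n" using sub \<open>(r', c) \<in> T\<close> by (auto simp: positions_def)
  moreover have "r \<notin> fst ` (T - {(r', c)})" using \<open>r \<notin> fst ` T\<close> by auto
  ultimately show "k_assignment k m n S"
    unfolding S_def l using \<open>r < m\<close> by (intro k_assignment_insert)
  show "snd ` S = snd ` T" using \<open>(r', c) \<in> T\<close> by (force simp: S_def)
  have "r \<noteq> r'" using assms(2,4) by force
  then show "r' \<notin> fst ` S"
    using inj(1) \<open>(r', c) \<in> T\<close> by (force simp: S_def inj_on_def)
qed

section \<open>Covers and augmentation along zeros\<close>

text \<open>A cover that is too small is padded by rows alone, for which \<open>s \<le> m\<close>
  leaves room. The set of columns stays the same, so a column missing from \<open>C\<close> is still
  missing afterwards.\<close>

lemma cover_of_size:
  assumes "R \<subseteq> {..<m}" "C \<subseteq> {..<n}" "\<forall>(i, j)\<in>Z. i \<in> R \<or> j \<in> C"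
    and "card R + card C \<le> s" "s \<le> m"
  shows "\<exists>R'. is_cover m n Z s R' C"
proof -
  have "\<exists>R'. R \<subseteq> R' \<and> R' \<subseteq> {..<m} \<and> card R' = s - card C"
    by (rule exists_subset_between) (use assms in auto)
  then obtain R' where "R \<subseteq> R'" "R' \<subseteq> {..<m}" "card R' = s - card C" by blast
  then have "is_cover m n Z s R' C"
    using assms unfolding is_cover_def by auto
  then show ?thesis ..
qed

text \<open>
  The set A below is a maximal set of rows that can be freed, one at a time, by moving T along
  zeros. If no row of A has a zero in a column not used by T, then the rows outside A and
  the columns used by T in the rows of A form a cover that is too small, as in the proof of
  Koenig's theorem.
\<close>

lemma augment_assignment:
  fixes a :: "nat \<times> nat \<Rightarrow> real"
  assumes T: "k_assignment l m n T" and c: "c < n" "c \<notin> snd ` T"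
    and l: "l < m"
    and Z: "Z \<subseteq> positions m n"
    and nonneg: "\<And>p. p \<in> positions m n \<Longrightarrow> 0 \<le> a p"
    and zero: "\<And>p. p \<in> Z \<Longrightarrow> a p = 0"
    and cov: "\<And>R C. is_cover m n Z l R C \<Longrightarrow> c \<in> C"
  shows "\<exists>S. k_assignment (Suc l) m n S \<and> sum a S \<le> sum a T"
proof (rule ccontr)
  assume neg: "\<not> ?thesis"
  \<comment> \<open>\<open>T'\<close> is a rearrangement of \<open>T\<close>, at no greater cost,
    that frees row \<open>r\<close>. The last conjunct says that only rows of \<open>A\<close> are
    disturbed, so an entry of \<open>T\<close> in another row is still present in \<open>T'\<close>
    and can be moved next.\<close>
  define good where "good A r T' \<longleftrightarrow> k_assignment l m n T' \<and> snd ` T' = snd ` T \<and>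
      sum a T' \<le> sum a T \<and> r \<notin> fst ` T' \<and> {p\<in>T'. fst p \<notin> A} = {p\<in>T. fst p \<notin> A}"
    for A r T'
  define F where "F = {A. {..<m} - fst ` T \<subseteq> A \<and> A \<subseteq> {..<m} \<and> (\<forall>r\<in>A. \<exists>T'. good A r T')}"
  have finT: "finite T" and Tsub: "T \<subseteq> positions m n" and cardT: "card T = l"
    and inj: "inj_on fst T" "inj_on snd T"
    using T k_assignment_finite[OF T] by (auto simp: k_assignment_def)
  have "finite F" by (rule finite_subset[of _ "Pow {..<m}"]) (auto simp: F_def)
  \<comment> \<open>The rows that \<open>T\<close> leaves free are the starting point, with
    \<open>T\<close> itself as the witness.\<close>
  moreover have "{..<m} - fst ` T \<in> F"
    using T by (auto simp: F_def good_def intro!: exI[of _ T])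
  ultimately obtain A where "A \<in> F" and Amax: "\<And>B. B \<in> F \<Longrightarrow> A \<subseteq> B \<Longrightarrow> A = B"
    using finite_has_maximal[of F] by auto
  then have A: "{..<m} - fst ` T \<subseteq> A" "A \<subseteq> {..<m}" "\<And>r. r \<in> A \<Longrightarrow> \<exists>T'. good A r T'"
    by (auto simp: F_def)
  have closed: "j \<in> snd ` {p\<in>T. fst p \<in> A}" if "r \<in> A" "(r, j) \<in> Z" for r j
  proof (rule ccontr)
    assume not: "\<not> ?thesis"
    obtain T' where T': "k_assignment l m n T'" "snd ` T' = snd ` T" "sum a T' \<le> sum a T"
        "r \<notin> fst ` T'" "{p\<in>T'. fst p \<notin> A} = {p\<in>T. fst p \<notin> A}"
      using A(3)[OF \<open>r \<in> A\<close>] by (auto simp: good_def)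
    have rj: "r < m" "j < n" using Z that(2) by (auto simp: positions_def)
    have finT': "finite T'" by (rule k_assignment_finite[OF T'(1)])
    have rT': "(r, j) \<notin> T'" using T'(4) by force
    show False
    proof (cases "j \<in> snd ` T")
      \<comment> \<open>The column is free in \<open>T'\<close> too, so the zero extends
        \<open>T'\<close> at no cost, against \<open>neg\<close>.\<close>
      case False
      have "k_assignment (Suc l) m n (insert (r, j) T')"
        using k_assignment_insert[OF T'(1) rj T'(4)] False T'(2) by simp
      moreover have "sum a (insert (r, j) T') \<le> sum a T"
        using finT' rT' T'(3) zero[OF that(2)] by simp
      ultimately show False using neg by blast
    next
      case True
      \<comment> \<open>The entry of \<open>T\<close> in column \<open>j\<close> lies in a row
        \<open>r2\<close> outside \<open>A\<close>, hence also in \<open>T'\<close>. Moving it along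
        the column to row \<open>r\<close> frees \<open>r2\<close>, so \<open>A\<close> was not
        maximal.\<close>
      then obtain r2 where r2: "(r2, j) \<in> T" by auto
      with not have r2A: "r2 \<notin> A" by force
      with r2 have "(r2, j) \<in> {p\<in>T. fst p \<notin> A}" by simp
      then have r2T': "(r2, j) \<in> T'" unfolding T'(5)[symmetric] by simp
      define T2 where "T2 = insert (r, j) (T' - {(r2, j)})"
      have T2: "k_assignment l m n T2" "snd ` T2 = snd ` T" "r2 \<notin> fst ` T2"
        using k_assignment_swap[OF T'(1) r2T' rj(1) T'(4)] T'(2) by (auto simp: T2_def)
      \<comment> \<open>The entry added is a zero and the entry removed is nonnegative, so the swap
        does not raise the cost.\<close>
      have "sum a T2 = sum a (T' - {(r2, j)})"
        using finT' rT' zero[OF that(2)] by (simp add: T2_def)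
      also have "\<dots> \<le> sum a T'"
        using finT' T'(1) nonneg by (intro sum_mono2) (auto simp: k_assignment_def)
      finally have cost: "sum a T2 \<le> sum a T" using T'(3) by linarith
      \<comment> \<open>Enlarging \<open>A\<close> weakens the agreement condition, so the witnesses
        for the old rows survive.\<close>
      have eq: "{p\<in>U. fst p \<notin> insert r2 A} = {p\<in>T. fst p \<notin> insert r2 A}"
        if "{p\<in>U. fst p \<notin> A} = {p\<in>T. fst p \<notin> A}" for U
        using that unfolding set_eq_iff by blast
      have "{p\<in>T2. fst p \<notin> insert r2 A} = {p\<in>T'. fst p \<notin> insert r2 A}"
        using \<open>r \<in> A\<close> by (auto simp: T2_def)
      with eq[OF T'(5)] T2 cost have "good (insert r2 A) r2 T2" by (simp add: good_def)
      moreover have "\<exists>U. good (insert r2 A) s U" if "s \<in> A" for s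
      proof -
        obtain U where "good A s U" using A(3) \<open>s \<in> A\<close> by blast
        then have "good (insert r2 A) s U" using eq unfolding good_def by blast
        then show ?thesis ..
      qed
      moreover have "r2 < m" using r2 Tsub by (auto simp: positions_def)
      ultimately have "insert r2 A \<in> F" using A(1,2) by (auto simp: F_def)
      then show False using Amax r2A by blast
    qed
  qed
  let ?R = "{..<m} - A" and ?C = "snd ` {p\<in>T. fst p \<in> A}"
  \<comment> \<open>Every row outside \<open>A\<close> is used by \<open>T\<close>. Thus each member
    of the cover is charged to an entry of \<open>T\<close>, rows to entries outside
    \<open>A\<close> and columns to entries inside.\<close>
  have "card ?R \<le> card {p\<in>T. fst p \<notin> A}"
    using A(1) finT by (intro surj_card_le[of _ _ fst]) auto
  moreover have "card ?C \<le> card {p\<in>T. fst p \<in> A}"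
    using finT by (intro card_image_le) auto
  moreover have "card {p\<in>T. fst p \<in> A} + card {p\<in>T. fst p \<notin> A} = card T"
    using finT by (subst card_Un_disjoint[symmetric]) (auto intro: arg_cong[of _ _ card])
  ultimately have "card ?R + card ?C \<le> l" using cardT by linarith
  moreover have "?C \<subseteq> {..<n}" using Tsub by (auto simp: positions_def)
  moreover have "\<forall>(i, j)\<in>Z. i \<in> ?R \<or> j \<in> ?C"
    using closed Z by (auto simp: positions_def)
  ultimately obtain R where "is_cover m n Z l R ?C"
    using cover_of_size[of ?R m ?C n Z l] l by auto
  \<comment> \<open>All columns of the padded cover are used by \<open>T\<close>, whereas
    \<open>c\<close> is not.\<close>
  then have "c \<in> ?C" by (rule cov)
  then show False using c by auto
qed

section \<open>Minimal cost after deletion of the first column\<close>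

text \<open>Embeds the positions of the reduced matrix into the original one, onto the positions
  outside column 0.\<close>

definition shift_column :: "nat \<times> nat \<Rightarrow> nat \<times> nat" where
  "shift_column = map_prod id Suc"

lemma fst_shift_column [simp]: "fst (shift_column p) = fst p"
  and snd_shift_column [simp]: "snd (shift_column p) = Suc (snd p)"
  by (simp_all add: shift_column_def)

lemma shift_column_eq_iff [simp]: "shift_column p = shift_column q \<longleftrightarrow> p = q"
  by (cases p; cases q) (simp add: shift_column_def)

lemma inj_shift_column: "inj_on shift_column A"
  by (simp add: inj_on_def)

lemma sum_shift_column: "sum a (shift_column ` S) = sum (a \<circ> shift_column) S"
  by (rule sum.reindex[OF inj_shift_column])

lemma delete_first_column_iff: "p \<in> delete_first_column Z \<longleftrightarrow> shift_column p \<in> Z"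
  by (cases p) (simp add: delete_first_column_def shift_column_def)

lemma k_assignment_shift_column:
  "k_assignment k m (Suc n) (shift_column ` S) \<longleftrightarrow> k_assignment k m n S"
proof -
  have "shift_column ` S \<subseteq> positions m (Suc n) \<longleftrightarrow> S \<subseteq> positions m n"
    by (fastforce simp: shift_column_def positions_def)
  then show ?thesis
    by (simp add: k_assignment_def card_image inj_shift_column) (simp add: inj_on_def)
qed

lemma ex_shift_column_image:
  assumes "0 \<notin> snd ` S"
  shows "\<exists>S'. S = shift_column ` S'"
proof -
  have "S = shift_column ` {p. shift_column p \<in> S}"
  proof (intro set_eqI iffI)
    fix p assume "p \<in> S"
    with assms obtain i j where "p = shift_column (i, j)"
      by (cases p; cases "snd p") (force simp: shift_column_def)+
    with \<open>p \<in> S\<close> show "p \<in> shift_column ` {p. shift_column p \<in> S}" by blast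
  qed auto
  then show ?thesis ..
qed

lemma min_cost_le: "k_assignment k m n S \<Longrightarrow> min_cost k m n a \<le> sum a S"
  unfolding min_cost_def by (intro Min_le) (auto simp: finite_k_assignments)

lemma min_cost_attained:
  assumes "k \<le> m" "k \<le> n"
  shows "\<exists>S. k_assignment k m n S \<and> min_cost k m n a = sum a S"
proof -
  have "min_cost k m n a \<in> (\<lambda>S. \<Sum>p\<in>S. a p) ` {S. k_assignment k m n S}"
    unfolding min_cost_def using ex_k_assignment[OF assms]
    by (intro Min_in) (auto simp: finite_k_assignments)
  then show ?thesis by blast
qed

lemma min_cost_cong:
  assumes "\<And>p. p \<in> positions m n \<Longrightarrow> a p = b p"
  shows "min_cost k m n a = min_cost k m n b"
  unfolding min_cost_def
  by (intro arg_cong[of _ _ Min] image_cong refl sum.cong)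
     (auto simp: k_assignment_def intro: assms)

text \<open>This is the deterministic core, for a fixed nonnegative matrix: augmentation in the free
  column 0 gives one inequality, removal of one entry the other.\<close>

lemma min_cost_delete_first_column:
  fixes a :: "nat \<times> nat \<Rightarrow> real"
  assumes l: "l < m" "l \<le> n"
    and Z: "Z \<subseteq> positions m (Suc n)"
    and nonneg: "\<And>p. p \<in> positions m (Suc n) \<Longrightarrow> 0 \<le> a p"
    and zero: "\<And>p. p \<in> Z \<Longrightarrow> a p = 0"
    and cov: "\<And>R C. is_cover m (Suc n) Z l R C \<Longrightarrow> 0 \<in> C"
  shows "min_cost (Suc l) m (Suc n) a = min_cost l m n (a \<circ> shift_column)"
proof (rule antisym)
  obtain T where T: "k_assignment l m n T" "min_cost l m n (a \<circ> shift_column) = sum (a \<circ> shift_column) T"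
    using min_cost_attained[of l m n "a \<circ> shift_column"] l by (metis less_imp_le)
  have "0 \<notin> snd ` (shift_column ` T)" by (auto simp: shift_column_def)
  then obtain S where "k_assignment (Suc l) m (Suc n) S" "sum a S \<le> sum a (shift_column ` T)"
    using augment_assignment[of l m "Suc n" "shift_column ` T" 0 Z a]
      T(1) k_assignment_shift_column l Z nonneg zero cov by auto
  then show "min_cost (Suc l) m (Suc n) a \<le> min_cost l m n (a \<circ> shift_column)"
    using min_cost_le[of "Suc l" m "Suc n" S a] T(2) by (simp add: sum_shift_column)
next
  obtain S where S: "k_assignment (Suc l) m (Suc n) S" "min_cost (Suc l) m (Suc n) a = sum a S"
    using min_cost_attained[of "Suc l" m "Suc n" a] l by (metis Suc_leI Suc_le_mono)
  have Sprops: "S \<subseteq> positions m (Suc n)" "inj_on snd S" "card S = Suc l"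
    using S(1) by (auto simp: k_assignment_def)
  \<comment> \<open>At most one entry of \<open>S\<close> lies in column 0. Removing it, or an
    arbitrary entry if there is none, leaves a set that comes from the reduced matrix.\<close>
  have "\<exists>p\<in>S. 0 \<notin> snd ` (S - {p})"
  proof (cases "0 \<in> snd ` S")
    case True
    then obtain p where "p \<in> S" "snd p = 0" by force
    then show ?thesis using Sprops(2) by (intro bexI[of _ p]) (auto simp: inj_on_def)
  next
    case False
    moreover obtain p where "p \<in> S" using Sprops(3) by (metis all_not_in_conv card.empty nat.distinct(1))
    ultimately show ?thesis by auto
  qed
  then obtain p where p: "p \<in> S" "0 \<notin> snd ` (S - {p})" by blast
  from ex_shift_column_image[OF p(2)] obtain T where T: "S - {p} = shift_column ` T" ..
  have "k_assignment l m n T"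
    using k_assignment_remove[OF S(1) p(1)] T k_assignment_shift_column by simp
  then have "min_cost l m n (a \<circ> shift_column) \<le> sum (a \<circ> shift_column) T" by (rule min_cost_le)
  also have "\<dots> = sum a (S - {p})" by (simp add: T sum_shift_column)
  also have "\<dots> \<le> sum a S"
    using Sprops(1) k_assignment_finite[OF S(1)] nonneg by (intro sum_mono2) auto
  finally show "min_cost l m n (a \<circ> shift_column) \<le> min_cost (Suc l) m (Suc n) a"
    using S(2) by simp
qed

section \<open>Transfer to expectations\<close>

text \<open>Sample points may have negative coordinates, so nonnegativity holds only almost surely,
  because the exponential density vanishes on negative numbers.\<close>

lemma AE_rap_space_nonneg:
  "AE \<omega> in rap_space m n Z. \<forall>p\<in>positions m n. 0 \<le> rap_entry Z \<omega> p"
proof -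
  have "AE \<omega> in rap_space m n Z. 0 \<le> \<omega> p" if "p \<in> positions m n - Z" for p
    unfolding rap_space_def
  proof (rule AE_PiM_component[OF _ that])
    show "AE x in density lborel (\<lambda>x. ennreal (exponential_density 1 x)). 0 \<le> x"
      by (subst AE_density) (auto simp: exponential_density_def)
  qed (rule prob_space_exponential_density, simp)
  then have "AE \<omega> in rap_space m n Z. 0 \<le> rap_entry Z \<omega> p" if "p \<in> positions m n" for p
    using that by (cases "p \<in> Z") (auto simp: rap_entry_def)
  then show ?thesis by (intro AE_finite_allI) auto
qed

lemma measurable_min_cost:
  "(\<lambda>\<omega>. min_cost k m n (rap_entry Z \<omega>)) \<in> borel_measurable (rap_space m n Z)"
proof -
  have "(\<lambda>\<omega>. rap_entry Z \<omega> p) \<in> borel_measurable (rap_space m n Z)" if "p \<in> positions m n" for p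
  proof (cases "p \<in> Z")
    case False
    with that have "(\<lambda>\<omega>. \<omega> p) \<in> measurable (rap_space m n Z)
        (density lborel (\<lambda>x. ennreal (exponential_density 1 x)))"
      unfolding rap_space_def by (intro measurable_component_singleton) auto
    with False show ?thesis by (simp add: rap_entry_def)
  qed (simp add: rap_entry_def)
  then show ?thesis
    unfolding min_cost_def
    by (intro borel_measurable_Min finite_k_assignments borel_measurable_sum)
       (auto simp: k_assignment_def)
qed

text \<open>Forgetting the random entries of column 0 and renumbering the others maps one product
  measure to the other. The almost sure equality of minimal costs therefore becomes an equality of
  integrals.\<close>

lemma rap_expectation_delete_first_column:
  assumes l: "l < m" "l \<le> n"
    and Z: "Z \<subseteq> positions m (Suc n)"
    and cov: "\<And>R C. is_cover m (Suc n) Z l R C \<Longrightarrow> 0 \<in> C"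
  shows "rap_expectation (Suc l) m (Suc n) Z = rap_expectation l m n (delete_first_column Z)"
proof -
  let ?Z = "delete_first_column Z"
  let ?D = "density lborel (\<lambda>x. ennreal (exponential_density 1 x))"
  let ?I = "positions m n - ?Z" and ?K = "positions m (Suc n) - Z"
  \<comment> \<open>The restriction makes \<open>t \<omega>\<close> undefined outside
    \<open>?I\<close>, as is required of points of the product space over \<open>?I\<close>.\<close>
  define t :: "(nat \<times> nat \<Rightarrow> real) \<Rightarrow> nat \<times> nat \<Rightarrow> real"
    where "t \<omega> = (\<lambda>p\<in>?I. \<omega> (shift_column p))" for \<omega>
  have maps: "shift_column \<in> ?I \<rightarrow> ?K"
    by (auto simp: positions_def delete_first_column_iff) (auto simp: shift_column_def)
  have t_meas: "t \<in> measurable (rap_space m (Suc n) Z) (rap_space m n ?Z)"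
    unfolding t_def rap_space_def using maps
    by (intro measurable_restrict measurable_component_singleton) auto
  \<comment> \<open>Selecting coordinates along an injection of index sets yields the product over
    the smaller index set, since all factors are the same probability measure.\<close>
  have distr: "distr (rap_space m (Suc n) Z) (rap_space m n ?Z) t = rap_space m n ?Z"
    unfolding rap_space_def t_def
    by (rule distr_PiM_reindex[OF _ inj_shift_column maps])
       (rule prob_space_exponential_density, simp)
  have entry: "min_cost l m n (rap_entry ?Z (t \<omega>)) = min_cost l m n (rap_entry Z \<omega> \<circ> shift_column)" for \<omega>
    by (intro min_cost_cong) (auto simp: rap_entry_def t_def delete_first_column_iff)
  have "AE \<omega> in rap_space m (Suc n) Z.
      min_cost (Suc l) m (Suc n) (rap_entry Z \<omega>) = min_cost l m n (rap_entry ?Z (t \<omega>))"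
    using AE_rap_space_nonneg
  proof eventually_elim
    case (elim \<omega>)
    then show ?case
      unfolding entry by (intro min_cost_delete_first_column[OF l Z _ _ cov]) (auto simp: rap_entry_def)
  qed
  then have "rap_expectation (Suc l) m (Suc n) Z
      = (\<integral>\<omega>. min_cost l m n (rap_entry ?Z (t \<omega>)) \<partial>rap_space m (Suc n) Z)"
    unfolding rap_expectation_def
    by (intro integral_cong_AE measurable_min_cost measurable_compose[OF t_meas])
  also have "\<dots> = (\<integral>\<omega>. min_cost l m n (rap_entry ?Z \<omega>)
      \<partial>distr (rap_space m (Suc n) Z) (rap_space m n ?Z) t)"
    by (rule integral_distr[OF t_meas measurable_min_cost, symmetric])
  finally show ?thesis by (simp only: distr rap_expectation_def)
qed

section \<open>Partial covers and their numbers\<close>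

lemma insert_0_Suc_vimage:
  assumes "0 \<in> C"
  shows "insert 0 (Suc ` (Suc -` C)) = C"
proof (intro set_eqI iffI)
  fix x assume "x \<in> C" then show "x \<in> insert 0 (Suc ` (Suc -` C))" by (cases x) auto
qed (use assms in auto)

lemma card_eq_Suc_card_vimage:
  assumes "finite (Suc -` C)" "0 \<in> C"
  shows "card C = Suc (card (Suc -` C))"
proof -
  have "card (insert 0 (Suc ` (Suc -` C))) = Suc (card (Suc ` (Suc -` C)))"
    using assms(1) by (intro card_insert_disjoint finite_imageI) auto
  then show ?thesis
    by (simp only: insert_0_Suc_vimage[OF assms(2)] card_image[OF inj_Suc])
qed

text \<open>Dropping column 0 and renumbering is a bijection between the covers of the two problems,
  as every cover of the larger one contains that column. Hence column 0 may be added to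
  \<open>C\<close> or left out freely; the preimage under \<open>Suc\<close> ignores it.\<close>

lemma partial_cover_delete_first_column:
  assumes cov: "\<And>R C. is_cover m (Suc n) Z (Suc s) R C \<Longrightarrow> 0 \<in> C"
  shows "partial_cover m (Suc n) Z (Suc s) R C \<longleftrightarrow>
    partial_cover m n (delete_first_column Z) s R (Suc -` C)"
proof
  assume "partial_cover m (Suc n) Z (Suc s) R C"
  then obtain R' C' where R': "is_cover m (Suc n) Z (Suc s) R' C'" "R \<subseteq> R'" "C \<subseteq> C'"
    by (auto simp: partial_cover_def)
  have "0 \<in> C'" using R'(1) by (rule cov)
  have "finite C'" using R'(1) finite_subset by (auto simp: is_cover_def)
  have "card C' = Suc (card (Suc -` C'))"
    using \<open>finite C'\<close> \<open>0 \<in> C'\<close> by (intro card_eq_Suc_card_vimage finite_vimageI) auto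
  then have "is_cover m n (delete_first_column Z) s R' (Suc -` C')"
    using R'(1) by (auto simp: is_cover_def delete_first_column_def)
  then show "partial_cover m n (delete_first_column Z) s R (Suc -` C)"
    using R'(2) vimage_mono[OF R'(3)] unfolding partial_cover_def by (intro exI conjI)
next
  assume "partial_cover m n (delete_first_column Z) s R (Suc -` C)"
  then obtain R' C' where R': "is_cover m n (delete_first_column Z) s R' C'" "R \<subseteq> R'" "Suc -` C \<subseteq> C'"
    by (auto simp: partial_cover_def)
  have "finite C'" using R'(1) finite_subset by (auto simp: is_cover_def)
  have "i \<in> R' \<or> j \<in> insert 0 (Suc ` C')" if "(i, j) \<in> Z" for i j
  proof (cases j)
    case (Suc h)
    then have "(i, h) \<in> delete_first_column Z" using that by (simp add: delete_first_column_def)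
    then have "i \<in> R' \<or> h \<in> C'" using R'(1) by (auto simp: is_cover_def)
    then show ?thesis using Suc by auto
  qed simp
  then have "is_cover m (Suc n) Z (Suc s) R' (insert 0 (Suc ` C'))"
    using R'(1) \<open>finite C'\<close> by (auto simp: is_cover_def card_image)
  moreover have "C \<subseteq> insert 0 (Suc ` C')"
  proof
    fix x assume "x \<in> C" then show "x \<in> insert 0 (Suc ` C')" using R'(3) by (cases x) auto
  qed
  ultimately show "partial_cover m (Suc n) Z (Suc s) R C"
    using R'(2) unfolding partial_cover_def by (intro exI conjI)
qed

lemma partial_cover_bounded:
  "partial_cover m n Z s R C \<Longrightarrow> R \<subseteq> {..<m} \<and> C \<subseteq> {..<n} \<and> card R + card C \<le> s"
  unfolding partial_cover_def is_cover_def
  by (auto intro!: add_mono card_mono intro: finite_subset[OF _ finite_lessThan])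

lemma finite_partial_covers: "finite {(R, C). partial_cover m n Z s R C \<and> P R C}"
  by (rule finite_subset[of _ "Pow {..<m} \<times> Pow {..<n}"]) (auto dest: partial_cover_bounded)

text \<open>Part of a (k - 1)-cover has at most k - 1 members. This allows summation ranges to be
  cut.\<close>

lemma cover_coeff_eq_0:
  assumes "k - 1 < i + j"
  shows "cover_coeff k m n Z i j = 0"
  unfolding cover_coeff_def using assms finite_partial_covers[of m n Z "k - 1"]
  by (auto dest!: partial_cover_bounded)

text \<open>The first summand counts the partial covers without column 0, the second those with it.
  The case \<open>j = 0\<close> is separate because truncated subtraction would turn
  \<open>j - 1\<close> into 0, while an empty set of columns cannot contain column 0.\<close>

lemma cover_coeff_delete_first_column:
  assumes cov: "\<And>R C. is_cover m (Suc n) Z (Suc s) R C \<Longrightarrow> 0 \<in> C"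
  shows "cover_coeff (Suc (Suc s)) m (Suc n) Z i j =
    cover_coeff (Suc s) m n (delete_first_column Z) i j +
    (if j = 0 then 0 else cover_coeff (Suc s) m n (delete_first_column Z) i (j - 1))"
proof -
  let ?Z = "delete_first_column Z"
  define X where "X h = {(R, C). partial_cover m n ?Z s R C \<and> card R = i \<and> card C = h}" for h
  \<comment> \<open>\<open>f\<close> and \<open>g\<close> lift a partial cover of the reduced
    problem without and with column 0; their images are disjoint and exhaust the partial covers of
    the larger problem.\<close>
  define f where "f = map_prod (id :: nat set \<Rightarrow> nat set) (\<lambda>C. Suc ` C)"
  define g where "g = map_prod (id :: nat set \<Rightarrow> nat set) (\<lambda>C. insert 0 (Suc ` C))"
  define Y where "Y = (if j = 0 then {} else g ` X (j - 1))"
  have fin: "finite (X h)" for h unfolding X_def by (rule finite_partial_covers)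
  have finC: "finite C" if "partial_cover m n ?Z s R C" for R C
    using partial_cover_bounded[OF that] finite_subset by blast
  have [simp]: "Suc -` Suc ` C = C" "Suc -` insert 0 (Suc ` C) = C" for C
    by auto
  have "{(R, C). partial_cover m (Suc n) Z (Suc s) R C \<and> card R = i \<and> card C = j}
      = f ` X j \<union> Y" (is "?L = _")
  proof (intro set_eqI iffI)
    fix x assume "x \<in> ?L"
    then obtain R C where x: "x = (R, C)" "partial_cover m n ?Z s R (Suc -` C)"
        "card R = i" "card C = j"
      by (auto simp: partial_cover_delete_first_column[OF cov])
    have fin': "finite (Suc -` C)" using finC x(2) by blast
    show "x \<in> f ` X j \<union> Y"
    proof (cases "0 \<in> C")
      case False
      have C: "C = Suc ` (Suc -` C)"
      proof (intro set_eqI iffI)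
        fix y assume "y \<in> C" then show "y \<in> Suc ` (Suc -` C)" using False by (cases y) auto
      qed auto
      then have "card (Suc -` C) = j" using x(4) by (metis card_image inj_Suc)
      then have "x \<in> f ` X j"
        using x C by (intro image_eqI[of _ _ "(R, Suc -` C)"]) (auto simp: f_def X_def)
      then show ?thesis ..
    next
      case True
      have j: "j = Suc (card (Suc -` C))"
        using card_eq_Suc_card_vimage[OF fin' True] x(4) by simp
      have "x = g (R, Suc -` C)"
        by (simp only: g_def map_prod_simp id_apply insert_0_Suc_vimage[OF True] x(1))
      moreover have "(R, Suc -` C) \<in> X (j - 1)"
        using x j by (simp add: X_def)
      ultimately have "x \<in> Y"
        using j by (simp add: Y_def)
      then show ?thesis ..
    qed
  next
    fix x assume "x \<in> f ` X j \<union> Y"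
    then show "x \<in> ?L"
      unfolding X_def Y_def f_def g_def
      by (auto simp: partial_cover_delete_first_column[OF cov] card_image finC
          split: if_splits)
  qed
  moreover have "f ` X j \<inter> Y = {}"
  proof -
    have "Suc ` C \<noteq> insert 0 (Suc ` C')" for C C' by blast
    then show ?thesis by (auto simp: Y_def f_def g_def)
  qed
  moreover have "inj_on f A" for A
    by (auto simp: f_def inj_on_def inj_image_eq_iff[OF inj_Suc])
  moreover have "insert 0 (Suc ` C) = insert 0 (Suc ` C') \<longleftrightarrow> C = C'" for C C'
    by (subst insert_ident) (auto simp only: inj_image_eq_iff[OF inj_Suc] image_iff nat.distinct)
  then have "inj_on g A" for A
    by (auto simp: g_def inj_on_def)
  ultimately show ?thesis
    using fin by (simp add: cover_coeff_def X_def[symmetric] card_Un_disjoint card_image Y_def)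
qed

section \<open>The binomial identity and the sums in the cover formula\<close>

text \<open>Over the common denominator \<open>real n * real ((n - 1) choose j)\<close> the two
  reciprocals have numerators n - j and j + 1, by the absorption identities. The bound on
  \<open>j\<close> keeps all three binomial coefficients positive.\<close>

lemma inverse_binomial_sum:
  assumes "j < n"
  shows "1 / real (n choose j) + 1 / real (n choose Suc j) =
    real (Suc n) / (real n * real ((n - 1) choose j))"
proof -
  obtain N where n: "n = Suc N" using assms by (cases n) auto
  have pos: "real (N choose j) > 0" "real (n choose j) > 0" "real (n choose Suc j) > 0"
    using assms by (simp_all add: n del: binomial_Suc_Suc)
  have "Suc j * (n choose Suc j) = n * (N choose j)"
    unfolding n by (rule Suc_times_binomial)
  then have 1: "(real j + 1) * real (n choose Suc j) = real n * real (N choose j)"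
    by (metis of_nat_Suc of_nat_mult add.commute)
  have "(n - j) * (n choose j) = n * (N choose j)"
    unfolding n using binomial_absorb_comp[of "Suc N" j] by simp
  then have 2: "(real n - real j) * real (n choose j) = real n * real (N choose j)"
    using assms by (metis of_nat_diff of_nat_mult less_imp_le)
  have "1 / real (n choose Suc j) = (real j + 1) / (real n * real (N choose j))"
    by (subst frac_eq_eq) (use pos assms 1 in auto)
  moreover have "1 / real (n choose j) = (real n - real j) / (real n * real (N choose j))"
    by (subst frac_eq_eq) (use pos assms 2 in auto)
  ultimately show ?thesis
    by (simp add: n add_divide_distrib[symmetric])
qed

text \<open>The two parts of each coefficient give two sums over the smaller range, which the
  binomial identity joins term by term. The factor \<open>real (Suc n) / real n\<close> compensates
  the change of the prefactor from 1/(mn) to 1/(m(n+1)).\<close>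

lemma cover_sum_delete_first_column:
  assumes cov: "\<And>R C. is_cover m (Suc n) Z (Suc s) R C \<Longrightarrow> 0 \<in> C" and s: "s < n"
  shows "(\<Sum>(i, j)\<in>{(i, j). i + j < Suc (Suc s)}.
      real (cover_coeff (Suc (Suc s)) m (Suc n) Z i j) /
        (real ((m - 1) choose i) * real (n choose j))) =
    real (Suc n) / real n * (\<Sum>(i, j)\<in>{(i, j). i + j < Suc s}.
      real (cover_coeff (Suc s) m n (delete_first_column Z) i j) /
        (real ((m - 1) choose i) * real ((n - 1) choose j)))"
proof -
  define d where "d i j = real (cover_coeff (Suc s) m n (delete_first_column Z) i j)" for i j
  define b where "b i = real ((m - 1) choose i)" for i
  define c where "c j = real (n choose j)" for j
  define D where "D h = {(i, j). i + j < (h :: nat)}" for h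
  have fin: "finite (D h)" for h
    by (rule finite_subset[of _ "{..<h} \<times> {..<h}"]) (auto simp: D_def)
  have d_nonzero: "i + j < Suc s" if "d i j \<noteq> 0" for i j
    using that by (rule contrapos_np) (simp add: d_def cover_coeff_eq_0)
  have "(\<Sum>(i, j)\<in>D (Suc (Suc s)). real (cover_coeff (Suc (Suc s)) m (Suc n) Z i j) / (b i * c j))
    = (\<Sum>(i, j)\<in>D (Suc (Suc s)). d i j / (b i * c j))
      + (\<Sum>(i, j)\<in>D (Suc (Suc s)). (if j = 0 then 0 else d i (j - 1)) / (b i * c j))"
    unfolding sum.distrib[symmetric]
    by (intro sum.cong refl)
       (auto simp: cover_coeff_delete_first_column[OF cov] d_def add_divide_distrib)
  \<comment> \<open>The extra diagonal i + j = s + 1 contributes nothing, since \<open>d\<close>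
    counts parts of s-covers.\<close>
  also have "(\<Sum>(i, j)\<in>D (Suc (Suc s)). d i j / (b i * c j)) = (\<Sum>(i, j)\<in>D (Suc s). d i j / (b i * c j))"
    by (rule sum.mono_neutral_right[OF fin]) (auto simp: D_def dest: d_nonzero)
  \<comment> \<open>Only terms with positive \<open>j\<close> survive; their indices are those of
    the smaller range with \<open>j\<close> raised by one.\<close>
  also have "(\<Sum>(i, j)\<in>D (Suc (Suc s)). (if j = 0 then 0 else d i (j - 1)) / (b i * c j))
    = (\<Sum>(i, j)\<in>map_prod id Suc ` D (Suc s). (if j = 0 then 0 else d i (j - 1)) / (b i * c j))"
  proof (rule sum.mono_neutral_right[OF fin])
    show "\<forall>x\<in>D (Suc (Suc s)) - map_prod id Suc ` D (Suc s).
        (case x of (i, j) \<Rightarrow> (if j = 0 then 0 else d i (j - 1)) / (b i * c j)) = 0"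
    proof
      fix x assume x: "x \<in> D (Suc (Suc s)) - map_prod id Suc ` D (Suc s)"
      obtain i j where ij: "x = (i, j)" by (cases x)
      have "j = 0"
      proof (cases j)
        case (Suc h)
        then have "x = map_prod id Suc (i, h)" "(i, h) \<in> D (Suc s)" using x ij by (auto simp: D_def)
        then show ?thesis using x by blast
      qed
      then show "(case x of (i, j) \<Rightarrow> (if j = 0 then 0 else d i (j - 1)) / (b i * c j)) = 0"
        by (simp add: ij)
    qed
  qed (auto simp: D_def)
  also have "\<dots> = (\<Sum>(i, j)\<in>D (Suc s). d i j / (b i * c (Suc j)))"
    by (subst sum.reindex) (auto simp: inj_on_def case_prod_unfold intro!: sum.cong)
  also have "(\<Sum>(i, j)\<in>D (Suc s). d i j / (b i * c j)) + (\<Sum>(i, j)\<in>D (Suc s). d i j / (b i * c (Suc j)))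
    = real (Suc n) / real n * (\<Sum>(i, j)\<in>D (Suc s). d i j / (b i * real ((n - 1) choose j)))"
    unfolding sum.distrib[symmetric] sum_distrib_left
  proof (intro sum.cong refl, clarify)
    fix i j assume "(i, j) \<in> D (Suc s)"
    then have "j < n" using s by (simp add: D_def)
    have "d i j / (b i * c j) + d i j / (b i * c (Suc j)) = d i j / b i * (1 / c j + 1 / c (Suc j))"
      by (simp add: algebra_simps)
    also have "\<dots> = real (Suc n) / real n * (d i j / (b i * real ((n - 1) choose j)))"
      unfolding c_def inverse_binomial_sum[OF \<open>j < n\<close>] by (simp add: ac_simps)
    finally show "d i j / (b i * c j) + d i j / (b i * c (Suc j)) =
      real (Suc n) / real n * (d i j / (b i * real ((n - 1) choose j)))" .
  qed
  finally show ?thesis by (simp only: d_def b_def c_def D_def)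
qed

theorem theorem5p2:
  fixes k m n :: nat and Z :: "(nat \<times> nat) set"
  assumes "standard_rap k m n Z"
    and "1 \<le> k"
    and "\<And>R C. is_cover m n Z (k - 1) R C \<Longrightarrow> 0 \<in> C"
    and "cover_formula (k - 1) m (n - 1) (delete_first_column Z)"
  shows "cover_formula k m n Z"
proof -
  obtain l where l: "k = Suc l" using assms(2) by (cases k) auto
  obtain n' where n': "n = Suc n'" using assms(1) l by (cases n) (auto simp: standard_rap_def)
  have bounds: "l < m" "l \<le> n'" and Z: "Z \<subseteq> positions m (Suc n')"
    using assms(1) by (auto simp: standard_rap_def l n')
  have cov: "\<And>R C. is_cover m (Suc n') Z l R C \<Longrightarrow> 0 \<in> C" using assms(3) by (simp add: l n')
  have E: "rap_expectation k m n Z = rap_expectation l m n' (delete_first_column Z)"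
    unfolding l n' by (rule rap_expectation_delete_first_column[OF bounds Z cov])
  have formula: "cover_formula l m n' (delete_first_column Z)" using assms(4) by (simp add: l n')
  show ?thesis
  proof (cases l)
    case 0
    \<comment> \<open>For k = 1 a 0-cover would be empty and yet contain column 0, so there is none
      and all coefficients vanish. The formula for the reduced problem is an empty sum and gives
      expectation 0.\<close>
    have "\<not> is_cover m n Z 0 R C" for R C
    proof
      assume *: "is_cover m n Z 0 R C"
      then have "C \<subseteq> {..<n}" "card C = 0" by (auto simp: is_cover_def)
      then have "C = {}" by (metis card_0_eq finite_lessThan finite_subset)
      moreover have "0 \<in> C" using * cov by (simp add: 0 n')
      ultimately show False by simp
    qed
    then have "\<not> partial_cover m n Z 0 R C" for R C
      by (simp add: partial_cover_def)
    then show ?thesis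
      using formula E unfolding cover_formula_def cover_coeff_def by (simp add: 0 l)
  next
    case (Suc s)
    have "s < n'" using bounds Suc by simp
    \<comment> \<open>Needed to cancel the nonzero factor \<open>Suc n'\<close> in the prefactor
      against the sum identity while \<open>n'\<close> stays a genuine denominator.\<close>
    have "0 < n'" using \<open>s < n'\<close> by simp
    then show ?thesis
      using formula E
        cover_sum_delete_first_column[OF cov[unfolded Suc] \<open>s < n'\<close>, unfolded Suc]
      by (simp add: cover_formula_def l n' Suc del: of_nat_Suc)
  qed
qed

end
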